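(* Let $X$ be a nonempty set. For each term $t\in \mathrm{T}(X)$ there is a unique polynomial term $t'\in \mathrm{PT}(X)$ in normal form with respect to $\Rightarrow_{\mathcal R}$ such that $t\Rightarrow_{\mathcal R}^* t'$; in particular $t=_{E_{\mathrm{rd}}}t'$.
   Context: $\mathrm{T}(X)$ is the set (and term algebra) of all terms built from elements of $X$, constants $\hat 0,\hat 1$, and binary symbols $\hat+,\hat\times$ (infix). A term $s$ is simple if $s=\hat 0$, or $s$ contains neither $\hat 0$ nor any subterm of the form $\hat 1\hat\times s'$ or $s'\hat\times\hat 1$; $\mathrm{ST}(X)$ is the set of simple terms. A monomial term is a term built from elements of $X$ using only $\hat\times$. The set $\mathrm{PT}(X)$ of polynomial terms is the smallest $U\subseteq \mathrm{ST}(X)$ with: (a) $\hat 0,\hat 1$ and all monomial terms are in $U$; (b) if $s,t\in U\setminus\{\hat 0\}$ then $s\hat+t\in U$; (c) if $s$ is a monomial term and $t\in U\setminus\{\hat 0,\hat 1\}$ then $s\hat\times t\in U$. $\mathcal R$ is the term rewriting system with rules $\hat0\hat+z\to z$, $z\hat+\hat0\to z$, $\hat1\hat\times z\to z$, $z\hat\times\hat1\to z$, $\hat0\hat\times z\to\hat0$, $z\hat\times\hat0\to\hat0$, $(z_1\hat\times z_2)\hat\times z_3\to z_1\hat\times(z_2\hat\times z_3)$, $(z_1\hat+z_2)\hat\times z_3\to(z_1\hat\times z_3)\hat+(z_2\hat\times z_3)$ (elements of $X$ are treated as constants, and $z,z_1,z_2,z_3$ are variables to be substituted by arbitrary terms).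 $s\Rightarrow_{\mathcal R}t$ means $t$ arises from $s$ by replacing one subterm occurrence that is an instance of a left-hand side by the corresponding instance of the right-hand side; $\Rightarrow_{\mathcal R}^*$ is the reflexive-transitive closure. A term is in normal form if no $\Rightarrow_{\mathcal R}$-step applies to it. $=_{E_{\mathrm{rd}}}$ is the smallest congruence on the term algebra $\mathrm{T}(X)$ containing, for all $a,b,c\in \mathrm{T}(X)$, the pairs $(a\hat+(b\hat+c),(a\hat+b)\hat+c)$, $(a\hat+b,b\hat+a)$, $(a\hat+\hat0,a)$, $(a\hat\times(b\hat\times c),(a\hat\times b)\hat\times c)$, $(\hat1\hat\times a,a)$, $(a\hat\times\hat1,a)$, $(a\hat\times\hat0,\hat0)$, $(\hat0\hat\times a,\hat0)$, $((a\hat+b)\hat\times c,(a\hat\times c)\hat+(b\hat\times c))$. *)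

theory Defs
  imports Main
begin

datatype 'a trm =
    Gen 'a
  | Zero ("\<^bold>0")
  | One ("\<^bold>1")
  | Plus "'a trm" "'a trm" (infixl "\<^bold>+" 65)
  | Times "'a trm" "'a trm" (infixl "\<^bold>\<times>" 70)

inductive_set T :: "'a set \<Rightarrow> 'a trm set" for X :: "'a set" where
  T_Gen: "x \<in> X \<Longrightarrow> Gen x \<in> T X"
| T_Zero: "\<^bold>0 \<in> T X"
| T_One: "\<^bold>1 \<in> T X"
| T_Plus: "\<lbrakk>s \<in> T X; t \<in> T X\<rbrakk> \<Longrightarrow> s \<^bold>+ t \<in> T X"
| T_Times: "\<lbrakk>s \<in> T X; t \<in> T X\<rbrakk> \<Longrightarrow> s \<^bold>\<times> t \<in> T X"

fun subterms :: "'a trm \<Rightarrow> 'a trm set" where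
  "subterms (Gen x) = {Gen x}"
| "subterms \<^bold>0 = {\<^bold>0}"
| "subterms \<^bold>1 = {\<^bold>1}"
| "subterms (s \<^bold>+ t) = {s \<^bold>+ t} \<union> subterms s \<union> subterms t"
| "subterms (s \<^bold>\<times> t) = {s \<^bold>\<times> t} \<union> subterms s \<union> subterms t"

definition simple :: "'a trm \<Rightarrow> bool" where
  "simple s \<longleftrightarrow> s = \<^bold>0 \<or>
     (\<^bold>0 \<notin> subterms s \<and> (\<forall>s'. \<^bold>1 \<^bold>\<times> s' \<notin> subterms s \<and> s' \<^bold>\<times> \<^bold>1 \<notin> subterms s))"

definition ST :: "'a set \<Rightarrow> 'a trm set" where
  "ST X = {s \<in> T X. simple s}"

inductive_set monomials :: "'a set \<Rightarrow> 'a trm set" for X :: "'a set" where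
  mon_Gen: "x \<in> X \<Longrightarrow> Gen x \<in> monomials X"
| mon_Times: "\<lbrakk>s \<in> monomials X; t \<in> monomials X\<rbrakk> \<Longrightarrow> s \<^bold>\<times> t \<in> monomials X"

text \<open>Polynomial terms are the least set of simple terms with the closure properties below.
  The restriction to simple terms need not be imposed in the rules: the least closed set of
  arbitrary terms already consists of simple terms (lemma \<open>PT_subset_ST\<close>).\<close>

inductive_set PT :: "'a set \<Rightarrow> 'a trm set" for X :: "'a set" where
  PT_Zero: "\<^bold>0 \<in> PT X"
| PT_One: "\<^bold>1 \<in> PT X"
| PT_mon: "s \<in> monomials X \<Longrightarrow> s \<in> PT X"
| PT_Plus: "\<lbrakk>s \<in> PT X; s \<noteq> \<^bold>0; t \<in> PT X; t \<noteq> \<^bold>0\<rbrakk> \<Longrightarrow> s \<^bold>+ t \<in> PT X"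
| PT_Times: "\<lbrakk>s \<in> monomials X; t \<in> PT X; t \<noteq> \<^bold>0; t \<noteq> \<^bold>1\<rbrakk> \<Longrightarrow> s \<^bold>\<times> t \<in> PT X"

lemma monomial_simple:
  assumes "s \<in> monomials X"
  shows "s \<in> T X \<and> simple s \<and> s \<noteq> \<^bold>0 \<and> s \<noteq> \<^bold>1"
  using assms by induction (auto simp: simple_def intro: T.intros)

lemma PT_subset_ST: "PT X \<subseteq> ST X"
proof
  fix s assume "s \<in> PT X"
  then show "s \<in> ST X"
  proof induction
    case (PT_mon s)
    then show ?case using monomial_simple[of s X] by (simp add: ST_def)
  next
    case (PT_Times s t)
    then show ?case using monomial_simple[of s X]
      by (auto simp: ST_def simple_def intro: T.intros)
  qed (auto simp: ST_def simple_def intro: T.intros)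
qed

text \<open>All instances of the rewrite rules.\<close>

inductive rule_inst :: "'a trm \<Rightarrow> 'a trm \<Rightarrow> bool" where
  "rule_inst (\<^bold>0 \<^bold>+ z) z"
| "rule_inst (z \<^bold>+ \<^bold>0) z"
| "rule_inst (\<^bold>1 \<^bold>\<times> z) z"
| "rule_inst (z \<^bold>\<times> \<^bold>1) z"
| "rule_inst (\<^bold>0 \<^bold>\<times> z) \<^bold>0"
| "rule_inst (z \<^bold>\<times> \<^bold>0) \<^bold>0"
| "rule_inst ((z1 \<^bold>\<times> z2) \<^bold>\<times> z3) (z1 \<^bold>\<times> (z2 \<^bold>\<times> z3))"
| "rule_inst ((z1 \<^bold>+ z2) \<^bold>\<times> z3) ((z1 \<^bold>\<times> z3) \<^bold>+ (z2 \<^bold>\<times> z3))"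

text \<open>The step relation lives on terms over the whole type, but steps preserve \<open>T X\<close>
  (lemma \<open>step_T\<close>), so on \<open>T X\<close> it is the rewrite relation of that term algebra.\<close>

inductive step :: "'a trm \<Rightarrow> 'a trm \<Rightarrow> bool" (infix "\<Rightarrow>\<^sub>R" 50) where
  step_root: "rule_inst s t \<Longrightarrow> s \<Rightarrow>\<^sub>R t"
| step_PlusL: "s \<Rightarrow>\<^sub>R s' \<Longrightarrow> s \<^bold>+ t \<Rightarrow>\<^sub>R s' \<^bold>+ t"
| step_PlusR: "t \<Rightarrow>\<^sub>R t' \<Longrightarrow> s \<^bold>+ t \<Rightarrow>\<^sub>R s \<^bold>+ t'"
| step_TimesL: "s \<Rightarrow>\<^sub>R s' \<Longrightarrow> s \<^bold>\<times> t \<Rightarrow>\<^sub>R s' \<^bold>\<times> t"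
| step_TimesR: "t \<Rightarrow>\<^sub>R t' \<Longrightarrow> s \<^bold>\<times> t \<Rightarrow>\<^sub>R s \<^bold>\<times> t'"

abbreviation steps :: "'a trm \<Rightarrow> 'a trm \<Rightarrow> bool" (infix "\<Rightarrow>\<^sub>R\<^sup>*" 50) where
  "s \<Rightarrow>\<^sub>R\<^sup>* t \<equiv> step\<^sup>*\<^sup>* s t"

definition normal_form :: "'a trm \<Rightarrow> bool" where
  "normal_form s \<longleftrightarrow> \<not> (\<exists>t. s \<Rightarrow>\<^sub>R t)"

inductive_cases T_PlusE: "s \<^bold>+ t \<in> T X"
inductive_cases T_TimesE: "s \<^bold>\<times> t \<in> T X"

lemma step_T:
  assumes "s \<Rightarrow>\<^sub>R t" and "s \<in> T X"
  shows "t \<in> T X"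
  using assms
proof induction
  case (step_root s t)
  then show ?case
    by cases (auto elim!: T_PlusE T_TimesE intro: T.intros)
qed (auto elim!: T_PlusE T_TimesE intro: T.intros)

inductive eq_rd :: "'a set \<Rightarrow> 'a trm \<Rightarrow> 'a trm \<Rightarrow> bool" for X :: "'a set" where
  rd_refl: "a \<in> T X \<Longrightarrow> eq_rd X a a"
| rd_sym: "eq_rd X a b \<Longrightarrow> eq_rd X b a"
| rd_trans: "\<lbrakk>eq_rd X a b; eq_rd X b c\<rbrakk> \<Longrightarrow> eq_rd X a c"
| rd_cong_Plus: "\<lbrakk>eq_rd X a a'; eq_rd X b b'\<rbrakk> \<Longrightarrow> eq_rd X (a \<^bold>+ b) (a' \<^bold>+ b')"
| rd_cong_Times: "\<lbrakk>eq_rd X a a'; eq_rd X b b'\<rbrakk> \<Longrightarrow> eq_rd X (a \<^bold>\<times> b) (a' \<^bold>\<times> b')"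
| rd_add_assoc: "\<lbrakk>a \<in> T X; b \<in> T X; c \<in> T X\<rbrakk> \<Longrightarrow> eq_rd X (a \<^bold>+ (b \<^bold>+ c)) ((a \<^bold>+ b) \<^bold>+ c)"
| rd_add_comm: "\<lbrakk>a \<in> T X; b \<in> T X\<rbrakk> \<Longrightarrow> eq_rd X (a \<^bold>+ b) (b \<^bold>+ a)"
| rd_add_zero: "a \<in> T X \<Longrightarrow> eq_rd X (a \<^bold>+ \<^bold>0) a"
| rd_mult_assoc: "\<lbrakk>a \<in> T X; b \<in> T X; c \<in> T X\<rbrakk> \<Longrightarrow> eq_rd X (a \<^bold>\<times> (b \<^bold>\<times> c)) ((a \<^bold>\<times> b) \<^bold>\<times> c)"
| rd_one_mult: "a \<in> T X \<Longrightarrow> eq_rd X (\<^bold>1 \<^bold>\<times> a) a"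
| rd_mult_one: "a \<in> T X \<Longrightarrow> eq_rd X (a \<^bold>\<times> \<^bold>1) a"
| rd_mult_zero: "a \<in> T X \<Longrightarrow> eq_rd X (a \<^bold>\<times> \<^bold>0) \<^bold>0"
| rd_zero_mult: "a \<in> T X \<Longrightarrow> eq_rd X (\<^bold>0 \<^bold>\<times> a) \<^bold>0"
| rd_distrib: "\<lbrakk>a \<in> T X; b \<in> T X; c \<in> T X\<rbrakk> \<Longrightarrow>
    eq_rd X ((a \<^bold>+ b) \<^bold>\<times> c) ((a \<^bold>\<times> c) \<^bold>+ (b \<^bold>\<times> c))"

end

theory Submission
  imports Defs
begin

text \<open>
  The rewrite system computes a function. Reading a term from the inside out, every
  symbol can be replaced by an operation that returns an irreducible term for irreducible
  arguments: \<open>add\<close> drops zeros, and \<open>mul\<close> pushes its right argument through the left one,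
  distributing over sums and reassociating products to the right. Let \<open>nf\<close> be the resulting
  evaluation of terms.

  Existence holds because every simplification made by \<open>add\<close> and \<open>mul\<close> is an application of one
  of the rules (\<open>steps_nf\<close>), and the result is an irreducible polynomial term (\<open>normal_form_nf\<close>,
  \<open>nf_PT\<close>).

  For uniqueness there is no need to examine critical pairs or termination: \<open>nf\<close> is invariant under
  rewriting (\<open>nf_steps\<close>). This amounts to saying that the values of \<open>nf\<close> satisfy the rules as
  equations between \<open>add\<close> and \<open>mul\<close>, the essential one being associativity of \<open>mul\<close>.
  If now \<open>t\<close> rewrites to an irreducible term \<open>t'\<close>, then \<open>t'\<close>, which rewrites to \<open>nf t'\<close>, must
  be equal to it, so that \<open>t' = nf t' = nf t\<close>.

  Finally, every rule is a consequence of the axioms of \<open>eq_rd\<close>, so rewriting stays within one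
  congruence class (\<open>steps_eq_rd\<close>).
\<close>

definition add :: "'a trm \<Rightarrow> 'a trm \<Rightarrow> 'a trm" where
  "add s t = (if s = \<^bold>0 then t else if t = \<^bold>0 then s else s \<^bold>+ t)"

text \<open>The recursion is on the left factor alone, so \<open>mul\<close> is meaningful for an arbitrary left
  factor and only the right one has to be irreducible for the result to be so.\<close>

fun mul :: "'a trm \<Rightarrow> 'a trm \<Rightarrow> 'a trm" where
  "mul (Gen x) t = (if t = \<^bold>0 then \<^bold>0 else if t = \<^bold>1 then Gen x else Gen x \<^bold>\<times> t)"
| "mul \<^bold>0 t = \<^bold>0"
| "mul \<^bold>1 t = t"
| "mul (a \<^bold>+ b) t = add (mul a t) (mul b t)"
| "mul (a \<^bold>\<times> b) t = mul a (mul b t)"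

fun nf :: "'a trm \<Rightarrow> 'a trm" where
  "nf (Gen x) = Gen x"
| "nf \<^bold>0 = \<^bold>0"
| "nf \<^bold>1 = \<^bold>1"
| "nf (s \<^bold>+ t) = add (nf s) (nf t)"
| "nf (s \<^bold>\<times> t) = mul (nf s) (nf t)"

lemma steps_Plus: "s \<Rightarrow>\<^sub>R\<^sup>* s' \<Longrightarrow> t \<Rightarrow>\<^sub>R\<^sup>* t' \<Longrightarrow> s \<^bold>+ t \<Rightarrow>\<^sub>R\<^sup>* s' \<^bold>+ t'"
proof -
  assume "s \<Rightarrow>\<^sub>R\<^sup>* s'" then have "s \<^bold>+ t \<Rightarrow>\<^sub>R\<^sup>* s' \<^bold>+ t"
    by induction (auto intro: rtranclp.rtrancl_into_rtrancl step_PlusL)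
  moreover assume "t \<Rightarrow>\<^sub>R\<^sup>* t'" then have "s' \<^bold>+ t \<Rightarrow>\<^sub>R\<^sup>* s' \<^bold>+ t'"
    by induction (auto intro: rtranclp.rtrancl_into_rtrancl step_PlusR)
  ultimately show ?thesis by simp
qed

lemma steps_Times: "s \<Rightarrow>\<^sub>R\<^sup>* s' \<Longrightarrow> t \<Rightarrow>\<^sub>R\<^sup>* t' \<Longrightarrow> s \<^bold>\<times> t \<Rightarrow>\<^sub>R\<^sup>* s' \<^bold>\<times> t'"
proof -
  assume "s \<Rightarrow>\<^sub>R\<^sup>* s'" then have "s \<^bold>\<times> t \<Rightarrow>\<^sub>R\<^sup>* s' \<^bold>\<times> t"
    by induction (auto intro: rtranclp.rtrancl_into_rtrancl step_TimesL)
  moreover assume "t \<Rightarrow>\<^sub>R\<^sup>* t'" then have "s' \<^bold>\<times> t \<Rightarrow>\<^sub>R\<^sup>* s' \<^bold>\<times> t'"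
    by induction (auto intro: rtranclp.rtrancl_into_rtrancl step_TimesR)
  ultimately show ?thesis by simp
qed

lemma steps_rule: "rule_inst s t \<Longrightarrow> s \<Rightarrow>\<^sub>R\<^sup>* t"
  by (intro r_into_rtranclp step_root)

lemma steps_add: "s \<^bold>+ t \<Rightarrow>\<^sub>R\<^sup>* add s t"
  by (auto simp: add_def intro: steps_rule rule_inst.intros)

lemma steps_mul: "s \<^bold>\<times> t \<Rightarrow>\<^sub>R\<^sup>* mul s t"
proof (induction s arbitrary: t)
  case (Plus a b)
  have "(a \<^bold>+ b) \<^bold>\<times> t \<Rightarrow>\<^sub>R\<^sup>* a \<^bold>\<times> t \<^bold>+ b \<^bold>\<times> t" by (intro steps_rule rule_inst.intros)
  also have "a \<^bold>\<times> t \<^bold>+ b \<^bold>\<times> t \<Rightarrow>\<^sub>R\<^sup>* mul a t \<^bold>+ mul b t" by (intro steps_Plus Plus.IH)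
  also have "\<dots> \<Rightarrow>\<^sub>R\<^sup>* add (mul a t) (mul b t)" by (rule steps_add)
  finally show ?case by simp
next
  case (Times a b)
  have "(a \<^bold>\<times> b) \<^bold>\<times> t \<Rightarrow>\<^sub>R\<^sup>* a \<^bold>\<times> (b \<^bold>\<times> t)" by (intro steps_rule rule_inst.intros)
  also have "\<dots> \<Rightarrow>\<^sub>R\<^sup>* a \<^bold>\<times> mul b t" by (intro steps_Times Times.IH rtranclp.rtrancl_refl)
  also have "\<dots> \<Rightarrow>\<^sub>R\<^sup>* mul a (mul b t)" by (rule Times.IH)
  finally show ?case by simp
qed (auto intro: steps_rule rule_inst.intros)

lemma steps_nf: "t \<Rightarrow>\<^sub>R\<^sup>* nf t"
proof (induction t)
  case (Plus s t)
  then show ?case by (auto intro: rtranclp_trans[OF steps_Plus steps_add])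
next
  case (Times s t)
  then show ?case by (auto intro: rtranclp_trans[OF steps_Times steps_mul])
qed auto

inductive_cases rule_inst_GenE: "rule_inst (Gen x) u"
inductive_cases rule_inst_ZeroE: "rule_inst \<^bold>0 u"
inductive_cases rule_inst_OneE: "rule_inst \<^bold>1 u"
inductive_cases rule_inst_PlusE: "rule_inst (s \<^bold>+ t) u"
inductive_cases rule_inst_Gen_TimesE: "rule_inst (Gen x \<^bold>\<times> t) u"
inductive_cases step_GenE: "Gen x \<Rightarrow>\<^sub>R u"
inductive_cases step_ZeroE: "\<^bold>0 \<Rightarrow>\<^sub>R u"
inductive_cases step_OneE: "\<^bold>1 \<Rightarrow>\<^sub>R u"
inductive_cases step_PlusE: "s \<^bold>+ t \<Rightarrow>\<^sub>R u"
inductive_cases step_Gen_TimesE: "Gen x \<^bold>\<times> t \<Rightarrow>\<^sub>R u"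

lemma normal_form_Gen: "normal_form (Gen x)"
  and normal_form_Zero: "normal_form \<^bold>0"
  and normal_form_One: "normal_form \<^bold>1"
  unfolding normal_form_def
  by (auto elim: step_GenE step_ZeroE step_OneE rule_inst_GenE rule_inst_ZeroE rule_inst_OneE)

lemma normal_form_add: "normal_form s \<Longrightarrow> normal_form t \<Longrightarrow> normal_form (add s t)"
  unfolding normal_form_def add_def by (auto elim!: step_PlusE elim: rule_inst_PlusE)

lemma normal_form_Gen_Times:
  "normal_form t \<Longrightarrow> t \<noteq> \<^bold>0 \<Longrightarrow> t \<noteq> \<^bold>1 \<Longrightarrow> normal_form (Gen x \<^bold>\<times> t)"
  unfolding normal_form_def
  by (auto elim!: step_Gen_TimesE elim: rule_inst_Gen_TimesE step_GenE rule_inst_GenE)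

lemma normal_form_mul: "normal_form t \<Longrightarrow> normal_form (mul s t)"
  by (induction s arbitrary: t)
    (auto simp: normal_form_Gen normal_form_Zero normal_form_Gen_Times normal_form_add)

lemma normal_form_nf: "normal_form (nf t)"
  by (induction t)
    (auto simp: normal_form_Gen normal_form_Zero normal_form_One normal_form_add normal_form_mul)

lemma add_PT: "s \<in> PT X \<Longrightarrow> t \<in> PT X \<Longrightarrow> add s t \<in> PT X"
  by (auto simp: add_def intro: PT.intros)

lemma mul_PT: "s \<in> T X \<Longrightarrow> t \<in> PT X \<Longrightarrow> mul s t \<in> PT X"
  by (induction s arbitrary: t rule: T.induct) (auto intro: PT.intros monomials.intros add_PT)

lemma PT_subset_T: "PT X \<subseteq> T X"
  using PT_subset_ST by (auto simp: ST_def)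

lemma nf_PT: "t \<in> T X \<Longrightarrow> nf t \<in> PT X"
proof (induction rule: T.induct)
  case (T_Times s t)
  then show ?case using PT_subset_T by (auto intro: mul_PT)
qed (auto intro: PT.intros monomials.intros add_PT)

lemma mul_zero: "mul s \<^bold>0 = \<^bold>0"
  by (induction s) (auto simp: add_def)

lemma mul_add: "mul (add s t) u = add (mul s u) (mul t u)"
  by (auto simp: add_def)

text \<open>When the left factor is a generator, \<open>mul\<close> merely prefixes it to the right factor unless
  that is \<open>\<^bold>0\<close> or \<open>\<^bold>1\<close>, and the recursion for products then peels it off again. Sums reduce
  to their summands by right distributivity of \<open>mul\<close>.\<close>

lemma mul_assoc: "mul (mul s t) u = mul s (mul t u)"
  by (induction s arbitrary: t u) (auto simp: mul_add mul_zero)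

text \<open>This identity fails for reducible terms in place of \<open>nf t\<close>, since \<open>mul s \<^bold>1\<close> is
  irreducible for every \<open>s\<close>. It makes the rule \<open>z \<^bold>\<times> \<^bold>1 \<rightarrow> z\<close> preserve \<open>nf\<close>.\<close>

lemma mul_nf_one: "mul (nf t) \<^bold>1 = nf t"
  by (induction t) (auto simp: mul_add mul_assoc)

lemma nf_step: "s \<Rightarrow>\<^sub>R t \<Longrightarrow> nf s = nf t"
proof (induction rule: step.induct)
  case (step_root s t)
  then show ?case
    by cases (simp_all add: mul_zero mul_nf_one mul_assoc mul_add, simp_all add: add_def)
qed simp_all

lemma nf_steps: "s \<Rightarrow>\<^sub>R\<^sup>* t \<Longrightarrow> nf s = nf t"
  by (induction rule: rtranclp_induct) (auto dest: nf_step)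

lemma nf_normal_form: "normal_form t \<Longrightarrow> nf t = t"
  using steps_nf[of t] by (auto simp: normal_form_def elim: converse_rtranclpE)

lemma rule_inst_eq_rd: "rule_inst s t \<Longrightarrow> s \<in> T X \<Longrightarrow> eq_rd X s t"
proof (induction rule: rule_inst.induct)
  case (1 z)
  then show ?case
    by (auto elim!: T_PlusE intro: rd_trans[OF rd_add_comm rd_add_zero] T.intros)
qed (auto elim!: T_PlusE T_TimesE intro: eq_rd.intros)

lemma step_eq_rd: "s \<Rightarrow>\<^sub>R t \<Longrightarrow> s \<in> T X \<Longrightarrow> eq_rd X s t"
  by (induction rule: step.induct)
    (auto elim!: T_PlusE T_TimesE
      intro: rule_inst_eq_rd rd_cong_Plus rd_cong_Times rd_refl)

lemma steps_eq_rd: "s \<Rightarrow>\<^sub>R\<^sup>* t \<Longrightarrow> s \<in> T X \<Longrightarrow> eq_rd X s t"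
  by (induction rule: converse_rtranclp_induct)
    (auto intro: rd_refl rd_trans step_eq_rd dest: step_T)

theorem theorem6p13:
  fixes X :: "'a set"
  assumes "X \<noteq> {}"
  shows "\<forall>t \<in> T X.
    (\<exists>!t'. t' \<in> PT X \<and> normal_form t' \<and> t \<Rightarrow>\<^sub>R\<^sup>* t') \<and>
    (\<forall>t'. t' \<in> PT X \<and> normal_form t' \<and> t \<Rightarrow>\<^sub>R\<^sup>* t' \<longrightarrow> eq_rd X t t')"
proof (intro ballI conjI)
  fix t assume t: "t \<in> T X"
  show "\<exists>!t'. t' \<in> PT X \<and> normal_form t' \<and> t \<Rightarrow>\<^sub>R\<^sup>* t'"
  proof (intro ex1I conjI)
    show "nf t \<in> PT X" using t by (rule nf_PT)
    show "normal_form (nf t)" by (rule normal_form_nf)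
    show "t \<Rightarrow>\<^sub>R\<^sup>* nf t" by (rule steps_nf)
    show "t' = nf t" if "t' \<in> PT X \<and> normal_form t' \<and> t \<Rightarrow>\<^sub>R\<^sup>* t'" for t'
      using that nf_steps[of t t'] nf_normal_form[of t'] by simp
  qed
  show "\<forall>t'. t' \<in> PT X \<and> normal_form t' \<and> t \<Rightarrow>\<^sub>R\<^sup>* t' \<longrightarrow> eq_rd X t t'"
    using t by (auto intro: steps_eq_rd)
qed

end
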